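(* Consider a DC optimal transmission switching (DC OTS) problem on a connected grid $(N,E)$ that has at least one feasible solution. For each edge $(i,j)\in E$ let $$M_{ij} := B_{ij}\cdot\max_{P}\ \sum_{(u,v)\in P}\frac{\bar f_{uv}}{B_{uv}},$$ where the maximum is over all elementary paths $P$ from $i$ to $j$ in $(N,E)$. Then there exists an optimal solution $(p,f,\theta,x)$ of the DC OTS problem that is not cut off by these big-M values, i.e. that satisfies $$-(1-x_{ij})M_{ij}\le f_{ij}-B_{ij}(\theta_i-\theta_j)\le (1-x_{ij})M_{ij}\qquad\text{for all }(i,j)\in E.$$
   Context: The grid is a finite graph with bus (node) set $N$ and branch (edge) set $E$. Each branch is written as a pair $(i,j)$, which fixes a reference direction: a positive $f_{ij}$ is power flow from $i$ to $j$, and a negative value is flow from $j$ to $i$. Paths and connectivity ignore this direction, i.e. a path may traverse an edge either way. A path is elementary if it repeats no node. $G\subset N$ is the set of buses with generators. The data are: demands $d_i\in\mathbb{R}$ for $i\in N$; costs $c_i\in\mathbb{R}$ and production limits $p_i^{\min}\le p_i^{\max}$ for $i\in G$; susceptances $B_{ij}>0$ and flow capacities $\bar f_{ij}\ge 0$ for $(i,j)\in E$. The DC OTS problem is to minimize $\sum_{i\in G}c_ip_i$ over real variables $p=(p_i)_{i\in G}$, $f=(f_{ij})_{(i,j)\in E}$, $\theta=(\theta_i)_{i\in N}$ and binary variables $x=(x_{ij})_{(i,j)\in E}$ subject to: (1) $\sum_{j:(j,i)\in E}f_{ji}-\sum_{j:(i,j)\in E}f_{ij}=d_i$ for $i\in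 N\setminus G$; (2) $\sum_{j:(j,i)\in E}f_{ji}-\sum_{j:(i,j)\in E}f_{ij}+p_i=d_i$ for $i\in G$; (3) $f_{ij}=B_{ij}(\theta_i-\theta_j)x_{ij}$ for $(i,j)\in E$; (4) $-\bar f_{ij}x_{ij}\le f_{ij}\le \bar f_{ij}x_{ij}$ for $(i,j)\in E$; (5) $p_i^{\min}\le p_i\le p_i^{\max}$ for $i\in G$; (6) $x_{ij}\in\{0,1\}$ for $(i,j)\in E$. *)

theory Defs
  imports Complex_Main
begin

record 'a dc_ots =
  buses :: "'a set"
  branches :: "('a \<times> 'a) set"
  gens :: "'a set"
  demand :: "'a \<Rightarrow> real"
  cost :: "'a \<Rightarrow> real"
  pmin :: "'a \<Rightarrow> real"
  pmax :: "'a \<Rightarrow> real"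
  susc :: "'a \<times> 'a \<Rightarrow> real"
  cap :: "'a \<times> 'a \<Rightarrow> real"

definition dc_ots_data :: "'a dc_ots \<Rightarrow> bool" where
  "dc_ots_data I \<longleftrightarrow>
     finite (buses I) \<and>
     branches I \<subseteq> buses I \<times> buses I \<and>
     gens I \<subseteq> buses I \<and>
     (\<forall>i\<in>gens I. pmin I i \<le> pmax I i) \<and>
     (\<forall>(i, j)\<in>branches I. susc I (i, j) > 0 \<and> cap I (i, j) \<ge> 0)"

(* A path is the list of branches it uses, each kept in its reference direction whichever way
   it is traversed, so that data indexed by branches can be summed along the list directly.
   Loops and a branch (j, i) next to a branch (i, j) are not excluded. *)

definition opposite_end :: "'a \<Rightarrow> 'a \<times> 'a \<Rightarrow> 'a" where
  "opposite_end i e = (if i = fst e then snd e else fst e)"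

fun path :: "('a \<times> 'a) set \<Rightarrow> 'a \<Rightarrow> ('a \<times> 'a) list \<Rightarrow> 'a \<Rightarrow> bool" where
  "path E i [] j \<longleftrightarrow> i = j"
| "path E i (e # P) j \<longleftrightarrow>
     e \<in> E \<and> (i = fst e \<or> i = snd e) \<and> path E (opposite_end i e) P j"

fun path_nodes :: "'a \<Rightarrow> ('a \<times> 'a) list \<Rightarrow> 'a list" where
  "path_nodes i [] = [i]"
| "path_nodes i (e # P) = i # path_nodes (opposite_end i e) P"

definition elementary_path :: "('a \<times> 'a) set \<Rightarrow> 'a \<Rightarrow> ('a \<times> 'a) list \<Rightarrow> 'a \<Rightarrow> bool" where
  "elementary_path E i P j \<longleftrightarrow> path E i P j \<and> distinct (path_nodes i P)"

definition connected_grid :: "'a dc_ots \<Rightarrow> bool" where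
  "connected_grid I \<longleftrightarrow> (\<forall>i\<in>buses I. \<forall>j\<in>buses I. \<exists>P. path (branches I) i P j)"

definition net_inflow :: "'a dc_ots \<Rightarrow> ('a \<times> 'a \<Rightarrow> real) \<Rightarrow> 'a \<Rightarrow> real" where
  "net_inflow I f i =
     (\<Sum>j | (j, i) \<in> branches I. f (j, i)) - (\<Sum>j | (i, j) \<in> branches I. f (i, j))"

definition feasible ::
  "'a dc_ots \<Rightarrow> ('a \<Rightarrow> real) \<Rightarrow> ('a \<times> 'a \<Rightarrow> real) \<Rightarrow> ('a \<Rightarrow> real) \<Rightarrow> ('a \<times> 'a \<Rightarrow> real) \<Rightarrow> bool" where
  "feasible I p f \<theta> x \<longleftrightarrow>
     (\<forall>i\<in>buses I - gens I. net_inflow I f i = demand I i) \<and>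
     (\<forall>i\<in>gens I. net_inflow I f i + p i = demand I i) \<and>
     (\<forall>(i, j)\<in>branches I. f (i, j) = susc I (i, j) * (\<theta> i - \<theta> j) * x (i, j)) \<and>
     (\<forall>(i, j)\<in>branches I. - cap I (i, j) * x (i, j) \<le> f (i, j) \<and>
                           f (i, j) \<le> cap I (i, j) * x (i, j)) \<and>
     (\<forall>i\<in>gens I. pmin I i \<le> p i \<and> p i \<le> pmax I i) \<and>
     (\<forall>(i, j)\<in>branches I. x (i, j) \<in> {0, 1})"

definition total_cost :: "'a dc_ots \<Rightarrow> ('a \<Rightarrow> real) \<Rightarrow> real" where
  "total_cost I p = (\<Sum>i\<in>gens I. cost I i * p i)"

definition optimal ::
  "'a dc_ots \<Rightarrow> ('a \<Rightarrow> real) \<Rightarrow> ('a \<times> 'a \<Rightarrow> real) \<Rightarrow> ('a \<Rightarrow> real) \<Rightarrow> ('a \<times> 'a \<Rightarrow> real) \<Rightarrow> bool" where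
  "optimal I p f \<theta> x \<longleftrightarrow>
     feasible I p f \<theta> x \<and>
     (\<forall>p' f' \<theta>' x'. feasible I p' f' \<theta>' x' \<longrightarrow> total_cost I p \<le> total_cost I p')"

definition big_M :: "'a dc_ots \<Rightarrow> 'a \<times> 'a \<Rightarrow> real" where
  "big_M I = (\<lambda>(i, j). susc I (i, j) *
     Max {\<Sum>(u, v)\<leftarrow>P. cap I (u, v) / susc I (u, v) | P. elementary_path (branches I) i P j})"

lemma length_path_nodes: "length (path_nodes i P) = Suc (length P)"
  by (induction P arbitrary: i) auto

lemma path_nodes_subset:
  "path E i P j \<Longrightarrow> set P \<subseteq> E \<and> set (path_nodes i P) \<subseteq> insert i (fst ` E \<union> snd ` E)"
proof (induction P arbitrary: i)
  case Nil
  then show ?case by simp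
next
  case (Cons e P)
  then have e: "e \<in> E" and IH: "set P \<subseteq> E"
    "set (path_nodes (opposite_end i e) P) \<subseteq> insert (opposite_end i e) (fst ` E \<union> snd ` E)"
    by auto
  have "opposite_end i e \<in> fst ` E \<union> snd ` E"
    using e by (simp add: opposite_end_def)
  with IH have "set (path_nodes (opposite_end i e) P) \<subseteq> fst ` E \<union> snd ` E"
    by blast
  with e IH show ?case by auto
qed

(* The maximum in big_M is over a finite nonempty set, so Max is not underspecified there. *)

lemma finite_elementary_paths:
  assumes "finite E"
  shows "finite {P. elementary_path E i P j}"
proof -
  let ?V = "insert i (fst ` E \<union> snd ` E)"
  have "length P \<le> card ?V" if "elementary_path E i P j" for P
  proof -
    have "card (set (path_nodes i P)) = Suc (length P)"
      using that by (simp add: elementary_path_def distinct_card length_path_nodes)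
    moreover have "card (set (path_nodes i P)) \<le> card ?V"
    proof (rule card_mono)
      show "finite ?V" using assms by simp
      show "set (path_nodes i P) \<subseteq> ?V"
        using that path_nodes_subset[of E i P j] by (simp add: elementary_path_def)
    qed
    ultimately show ?thesis by simp
  qed
  then have "{P. elementary_path E i P j} \<subseteq> {P. set P \<subseteq> E \<and> length P \<le> card ?V}"
    by (auto dest: path_nodes_subset[THEN conjunct1, THEN subsetD] simp: elementary_path_def)
  then show ?thesis
    using finite_lists_length_le[OF assms] finite_subset by blast
qed

lemma ex_elementary_path:
  assumes "(i, j) \<in> E"
  shows "\<exists>P. elementary_path E i P j"
proof (cases "i = j")
  case True
  then have "elementary_path E i [] j" by (simp add: elementary_path_def)
  then show ?thesis ..
next
  case False
  with assms have "elementary_path E i [(i, j)] j"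
    by (simp add: elementary_path_def opposite_end_def)
  then show ?thesis ..
qed

end

(* If the branches in operation do not connect the grid, some switched-off branch joins
   two of their components. Shifting the angles of one component makes the angles at the two ends of
   that branch equal, so the branch can be switched on and carry zero flow: (p, f) stays the same.
   Hence every feasible (p, f) is attained with a connected graph of active branches. The flow limits
   along an active elementary path from i to j then bound the angle difference of i and j, which
   gives the big-M inequality for a switched-off branch (i, j). The same bound, after grounding the
   angle of one bus, confines a minimising sequence to a compact set, so an optimum exists. *)

theory Submission
  imports Defs
begin

section \<open>Elementary paths, cuts and telescoping along paths\<close>

lemma path_mono:
  assumes "path A i P j" and "A \<subseteq> E"
  shows "path E i P j"
  using assms by (induction P arbitrary: i) auto

text \<open>The part of \<open>P\<close> from \<open>k\<close> onwards inherits distinct nodes. This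
  is what cuts out a cycle when a walk is shortened.\<close>

lemma elementary_path_suffix:
  assumes "elementary_path E i P j" and "k \<in> set (path_nodes i P)"
  shows "\<exists>Q. elementary_path E k Q j"
  using assms
proof (induction P arbitrary: i)
  case (Cons e P)
  show ?case
  proof (cases "k = i")
    case False
    with Cons show ?thesis by (auto simp: elementary_path_def)
  qed (use Cons.prems in blast)
qed auto

text \<open>The rest of the path is made elementary first. If the start \<open>i\<close> recurs
  there, its suffix from \<open>i\<close> already does the job; otherwise \<open>e\<close> can be
  prepended. A loop falls under the first case.\<close>

lemma path_imp_elementary_path:
  assumes "path E i P j"
  shows "\<exists>Q. elementary_path E i Q j"
  using assms
proof (induction P arbitrary: i)
  case Nil
  then have "elementary_path E i [] j" by (simp add: elementary_path_def)
  then show ?case ..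
next
  case (Cons e P)
  then obtain Q where Q: "elementary_path E (opposite_end i e) Q j" by auto
  show ?case
  proof (cases "i \<in> set (path_nodes (opposite_end i e) Q)")
    case True
    with Q show ?thesis by (rule elementary_path_suffix)
  next
    case False
    with Q Cons.prems have "elementary_path E i (e # Q) j"
      by (simp add: elementary_path_def)
    then show ?thesis ..
  qed
qed

text \<open>Membership in \<open>C\<close> has to change along the path: either the first branch
  changes it, or the rest of the path still joins the two sides.\<close>

lemma path_crosses_cut:
  assumes "path E i P j" and "(i \<in> C) \<noteq> (j \<in> C)"
  shows "\<exists>e\<in>E. (fst e \<in> C) \<noteq> (snd e \<in> C)"
  using assms
proof (induction P arbitrary: i)
  case (Cons e P)
  then show ?case
    by (cases "(opposite_end i e \<in> C) = (i \<in> C)") (auto simp: opposite_end_def split: if_splits)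
qed simp

text \<open>A branch can be traversed from either end, so prepending \<open>e\<close> moves the
  start across it. Hence the set of nodes that reach \<open>j\<close> is a union of components,
  never split by a branch of \<open>A\<close>.\<close>

lemma ex_path_from_edge_ends:
  assumes "e \<in> A"
  shows "(\<exists>P. path A (fst e) P j) \<longleftrightarrow> (\<exists>P. path A (snd e) P j)"
proof
  assume "\<exists>P. path A (fst e) P j"
  then obtain P where "path A (fst e) P j" ..
  with assms have "path A (snd e) (e # P) j" by (auto simp: opposite_end_def)
  then show "\<exists>P. path A (snd e) P j" ..
next
  assume "\<exists>P. path A (snd e) P j"
  then obtain P where "path A (snd e) P j" ..
  with assms have "path A (fst e) (e # P) j" by (auto simp: opposite_end_def)
  then show "\<exists>P. path A (fst e) P j" ..
qed

text \<open>Triangle inequality along the path; the absolute values make the direction of traversal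
  irrelevant.\<close>

lemma path_potential_bound:
  fixes \<theta> :: "'a \<Rightarrow> real"
  assumes "path A i P j" and "\<And>e. e \<in> A \<Longrightarrow> \<bar>\<theta> (fst e) - \<theta> (snd e)\<bar> \<le> w e"
  shows "\<bar>\<theta> i - \<theta> j\<bar> \<le> sum_list (map w P)"
  using assms(1)
proof (induction P arbitrary: i)
  case (Cons e P)
  have "\<bar>\<theta> i - \<theta> (opposite_end i e)\<bar> \<le> w e"
    using Cons.prems assms(2)[of e] by (auto simp: opposite_end_def)
  moreover have "\<bar>\<theta> (opposite_end i e) - \<theta> j\<bar> \<le> sum_list (map w P)"
    using Cons by simp
  ultimately show ?case by simp
qed simp

section \<open>Angle differences bounded through active branches\<close>

definition active :: "'a dc_ots \<Rightarrow> ('a \<times> 'a \<Rightarrow> real) \<Rightarrow> ('a \<times> 'a) set" where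
  "active I x = {e \<in> branches I. x e = 1}"

text \<open>The maximum inside \<open>big_M\<close>, here for arbitrary pairs of buses: grounding
  the angles compares buses that need not be adjacent.\<close>

definition longest_path :: "'a dc_ots \<Rightarrow> 'a \<Rightarrow> 'a \<Rightarrow> real" where
  "longest_path I i j =
     Max {\<Sum>(u, v)\<leftarrow>P. cap I (u, v) / susc I (u, v) | P. elementary_path (branches I) i P j}"

lemma finite_branches: "dc_ots_data I \<Longrightarrow> finite (branches I)"
  unfolding dc_ots_data_def using finite_subset by blast

text \<open>On an active branch the flow equals susceptance times angle difference, so the capacity
  bounds the difference by \<open>cap / susc\<close>. These bounds add up along a path.\<close>

lemma active_potential_bound:
  assumes "dc_ots_data I" and feas: "feasible I p f \<theta> x" and "path (active I x) i P j"
  shows "\<bar>\<theta> i - \<theta> j\<bar> \<le> longest_path I i j"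
proof -
  let ?w = "\<lambda>(u, v). cap I (u, v) / susc I (u, v)"
  \<comment> \<open>The maximum ranges over elementary paths only, so the given path is shortened
    first.\<close>
  obtain Q where Q: "elementary_path (active I x) i Q j"
    using path_imp_elementary_path[OF assms(3)] by blast
  have w: "\<bar>\<theta> (fst e) - \<theta> (snd e)\<bar> \<le> ?w e" if e_active: "e \<in> active I x" for e
  proof -
    obtain u v where e: "e = (u, v)" "(u, v) \<in> branches I" "x (u, v) = 1"
      using e_active by (cases e) (auto simp: active_def)
    have "susc I (u, v) > 0" "f (u, v) = susc I (u, v) * (\<theta> u - \<theta> v)"
      "- cap I (u, v) \<le> f (u, v)" "f (u, v) \<le> cap I (u, v)"
      using e assms(1) feas unfolding dc_ots_data_def feasible_def by fastforce+
    then have "susc I (u, v) > 0" "susc I (u, v) * \<bar>\<theta> u - \<theta> v\<bar> \<le> cap I (u, v)"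
      using abs_mult[of "susc I (u, v)" "\<theta> u - \<theta> v"] by auto
    then show ?thesis using e(1) by (simp add: pos_le_divide_eq mult.commute)
  qed
  have "\<bar>\<theta> i - \<theta> j\<bar> \<le> sum_list (map ?w Q)"
    using Q w path_potential_bound[of "active I x" i Q j \<theta> ?w] by (simp add: elementary_path_def)
  also have "\<dots> \<le> longest_path I i j"
    unfolding longest_path_def
  proof (rule Max_ge)
    show "finite {sum_list (map ?w P) | P. elementary_path (branches I) i P j}"
      using finite_elementary_paths[OF finite_branches[OF assms(1)]] by simp
    have "elementary_path (branches I) i Q j"
      using Q path_mono[of "active I x" i Q j "branches I"]
      by (auto simp: elementary_path_def active_def)
    then show "sum_list (map ?w Q) \<in> {sum_list (map ?w P) | P. elementary_path (branches I) i P j}"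
      by blast
  qed
  finally show ?thesis .
qed

section \<open>Making the active graph connected without changing production or flow\<close>

text \<open>Since \<open>C\<close> is a union of active components, adding a constant to the angles
  on \<open>C\<close> preserves every angle difference on an active branch.\<close>

lemma switch_on_across_cut:
  assumes data: "dc_ots_data I" and feas: "feasible I p f \<theta> x"
    and e: "e \<in> branches I" "(fst e \<in> C) \<noteq> (snd e \<in> C)"
    and C: "\<And>e. e \<in> active I x \<Longrightarrow> fst e \<in> C \<longleftrightarrow> snd e \<in> C"
  shows "\<exists>\<theta>'. feasible I p f \<theta>' (x(e := 1))"
proof -
  \<comment> \<open>The shift that equalises the angles at the ends of \<open>e\<close>; its sign
    depends on which end lies in \<open>C\<close>.\<close>
  define \<delta> where
    "\<delta> = (if fst e \<in> C then \<theta> (snd e) - \<theta> (fst e) else \<theta> (fst e) - \<theta> (snd e))"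
  define \<theta>' where "\<theta>' k = (if k \<in> C then \<theta> k + \<delta> else \<theta> k)" for k
  have eq: "\<theta>' (fst e) = \<theta>' (snd e)"
    using e(2) by (auto simp: \<theta>'_def \<delta>_def)
  have xe: "x e = 0"
  proof -
    have "x e \<in> {0, 1}" using e(1) feas unfolding feasible_def by (cases e) auto
    moreover have "x e \<noteq> 1" using e C[of e] by (auto simp: active_def)
    ultimately show ?thesis by simp
  qed
  have fe: "f e = 0"
    using e(1) feas xe unfolding feasible_def by (cases e) auto
  have flow: "f (i, j) = susc I (i, j) * (\<theta>' i - \<theta>' j) * (x(e := 1)) (i, j)"
    if "(i, j) \<in> branches I" for i j
  proof (cases "(i, j) = e")
    case True
    with eq fe show ?thesis by auto
  next
    case False
    \<comment> \<open>If the branch is on, both ends lie on the same side of \<open>C\<close> and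
      the shift cancels; if it is off, both sides vanish whatever the angles are.\<close>
    have "f (i, j) = susc I (i, j) * (\<theta> i - \<theta> j) * x (i, j)" and "x (i, j) \<in> {0, 1}"
      using that feas unfolding feasible_def by auto
    then show ?thesis
      using False that C[of "(i, j)"] by (auto simp: \<theta>'_def active_def)
  qed
  \<comment> \<open>Zero flow respects the limits of the newly active \<open>e\<close> because its
    capacity is nonnegative.\<close>
  have "0 \<le> cap I e"
    using data e(1) unfolding dc_ots_data_def by (cases e) auto
  with fe feas flow have "feasible I p f \<theta>' (x(e := 1))"
    unfolding feasible_def by auto
  then show ?thesis by blast
qed

text \<open>Induction on the number of inactive branches: as long as the active graph is
  disconnected, one more branch can be switched on.\<close>

lemma feasible_connected:
  assumes data: "dc_ots_data I" and "connected_grid I" and "feasible I p f \<theta> x"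
  shows "\<exists>\<theta>' x'. feasible I p f \<theta>' x' \<and>
           (\<forall>i\<in>buses I. \<forall>j\<in>buses I. \<exists>P. path (active I x') i P j)"
  using assms(3)
proof (induction "card (branches I - active I x)" arbitrary: \<theta> x rule: less_induct)
  case less
  show ?case
  proof (cases "\<forall>i\<in>buses I. \<forall>j\<in>buses I. \<exists>P. path (active I x) i P j")
    case True
    with less.prems show ?thesis by blast
  next
    case False
    then obtain i j where ij: "i \<in> buses I" "j \<in> buses I" "\<nexists>P. path (active I x) i P j"
      by blast
    \<comment> \<open>The active component of \<open>j\<close>. It misses \<open>i\<close>, so
      connectedness of the whole grid yields a branch that leaves it.\<close>
    define C where "C = {k. \<exists>P. path (active I x) k P j}"
    have C: "fst e \<in> C \<longleftrightarrow> snd e \<in> C" if "e \<in> active I x" for e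
      using ex_path_from_edge_ends[OF that] by (simp add: C_def)
    have "path (active I x) j [] j" by simp
    then have "j \<in> C" unfolding C_def by blast
    moreover have "i \<notin> C" using ij(3) by (simp add: C_def)
    moreover obtain P where "path (branches I) i P j"
      using assms(2) ij unfolding connected_grid_def by blast
    ultimately obtain e where e: "e \<in> branches I" "(fst e \<in> C) \<noteq> (snd e \<in> C)"
      using path_crosses_cut[of "branches I" i P j C] by blast
    obtain \<theta>' where \<theta>': "feasible I p f \<theta>' (x(e := 1))"
      using switch_on_across_cut[OF data less.prems e C] by blast
    have "e \<notin> active I x" using C e(2) by blast
    then have "branches I - active I (x(e := 1)) \<subset> branches I - active I x"
      using e(1) by (auto simp: active_def)
    then have "card (branches I - active I (x(e := 1))) < card (branches I - active I x)"
      using finite_branches[OF data] by (intro psubset_card_mono) auto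
    from less.hyps[OF this \<theta>'] show ?thesis .
  qed
qed

section \<open>Compactness and existence of an optimum\<close>

text \<open>Angles matter only through differences, so bus \<open>r\<close> can be grounded at 0.
  The bound \<open>K\<close> depends on the data alone and thus serves a whole minimising
  sequence.\<close>

lemma feasible_bounded_potentials:
  assumes data: "dc_ots_data I" and conn: "connected_grid I"
  shows "\<exists>K. \<forall>p f \<theta> x. feasible I p f \<theta> x \<longrightarrow>
           (\<exists>\<theta>' x'. feasible I p f \<theta>' x' \<and> (\<forall>i\<in>buses I. \<bar>\<theta>' i\<bar> \<le> K i))"
proof -
  \<comment> \<open>Without buses \<open>r\<close> is an arbitrary value, but then the bound is
    claimed for no \<open>i\<close>.\<close>
  define r where "r = (SOME r. r \<in> buses I)"
  have "\<exists>\<theta>' x'. feasible I p f \<theta>' x' \<and> (\<forall>i\<in>buses I. \<bar>\<theta>' i\<bar> \<le> longest_path I i r)"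
    if feas: "feasible I p f \<theta> x" for p f \<theta> x
  proof -
    obtain \<theta>' x' where f': "feasible I p f \<theta>' x'"
      and c: "\<forall>i\<in>buses I. \<forall>j\<in>buses I. \<exists>P. path (active I x') i P j"
      using feasible_connected[OF data conn feas] by blast
    have "feasible I p f (\<lambda>i. \<theta>' i - \<theta>' r) x'"
      using f' unfolding feasible_def by simp
    moreover have "\<bar>\<theta>' i - \<theta>' r\<bar> \<le> longest_path I i r" if "i \<in> buses I" for i
    proof -
      have "r \<in> buses I" unfolding r_def using that by (rule someI)
      then show ?thesis
        using c that active_potential_bound[OF data f'] by blast
    qed
    ultimately show ?thesis by blast
  qed
  then show ?thesis by (intro exI[of _ "\<lambda>i. longest_path I i r"]) blast
qed

text \<open>Bolzano-Weierstrass in finitely many coordinates: each new coordinate is handled by a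
  further monotone subsequence, which keeps the limits already obtained.\<close>

lemma pointwise_convergent_subsequence:
  fixes g :: "nat \<Rightarrow> 'b \<Rightarrow> real"
  assumes "finite A" and "\<And>a. a \<in> A \<Longrightarrow> Bseq (\<lambda>n. g n a)"
  shows "\<exists>r l. strict_mono (r :: nat \<Rightarrow> nat) \<and> (\<forall>a\<in>A. (\<lambda>n. g (r n) a) \<longlonglongrightarrow> l a)"
  using assms
proof (induction A rule: finite_induct)
  case empty
  show ?case by (auto intro: exI[of _ id] simp: strict_mono_def)
next
  case (insert b A)
  then obtain r l where r: "strict_mono (r :: nat \<Rightarrow> nat)"
    and l: "\<And>a. a \<in> A \<Longrightarrow> (\<lambda>n. g (r n) a) \<longlonglongrightarrow> l a" by auto
  obtain s :: "nat \<Rightarrow> nat" where s: "strict_mono s" "monoseq (\<lambda>n. g (r (s n)) b)"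
    using seq_monosub[of "\<lambda>n. g (r n) b"] by blast
  have "Bseq (\<lambda>n. g (r (s n)) b)"
    using Bseq_subseq[of "\<lambda>n. g n b" "r \<circ> s"] insert.prems[of b] by (simp add: o_def)
  then obtain lb where lb: "(\<lambda>n. g (r (s n)) b) \<longlonglongrightarrow> lb"
    using Bseq_monoseq_convergent s(2) unfolding convergent_def by blast
  have "(\<lambda>n. g ((r \<circ> s) n) a) \<longlonglongrightarrow> (l(b := lb)) a" if "a \<in> insert b A" for a
    using that lb l[of a] insert.hyps LIMSEQ_subseq_LIMSEQ[of "\<lambda>n. g (r n) a" "l a" s] s(1)
    by (auto simp: o_def)
  then show ?case using strict_mono_o[OF r s(1)] by blast
qed

text \<open>All constraints, integrality included, are closed conditions and survive pointwise
  limits.\<close>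

lemma feasible_limit:
  assumes fin: "finite (branches I)" and feas: "\<And>n. feasible I (P n) (F n) (T n) (X n)"
    and P: "\<And>i. i \<in> gens I \<Longrightarrow> (\<lambda>n. P n i) \<longlonglongrightarrow> p i"
    and F: "\<And>e. e \<in> branches I \<Longrightarrow> (\<lambda>n. F n e) \<longlonglongrightarrow> f e"
    and T: "\<And>i j. (i, j) \<in> branches I \<Longrightarrow> (\<lambda>n. T n i - T n j) \<longlonglongrightarrow> \<theta> i - \<theta> j"
    and X: "\<And>e. e \<in> branches I \<Longrightarrow> (\<lambda>n. X n e) \<longlonglongrightarrow> x e"
  shows "feasible I p f \<theta> x"
proof -
  have inflow: "(\<lambda>n. net_inflow I (F n) i) \<longlonglongrightarrow> net_inflow I f i" for i
    unfolding net_inflow_def by (intro tendsto_intros F) auto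
  have "net_inflow I f i = demand I i" if "i \<in> buses I - gens I" for i
    using that feas inflow[of i] unfolding feasible_def by (simp add: LIMSEQ_const_iff)
  moreover have "net_inflow I f i + p i = demand I i" if "i \<in> gens I" for i
    using that feas tendsto_add[OF inflow[of i] P[of i]] unfolding feasible_def
    by (simp add: LIMSEQ_const_iff)
  moreover have "f (i, j) = susc I (i, j) * (\<theta> i - \<theta> j) * x (i, j)" if "(i, j) \<in> branches I" for i j
  proof (rule LIMSEQ_unique[OF F[OF that]])
    have "(\<lambda>n. susc I (i, j) * (T n i - T n j) * X n (i, j))
            \<longlonglongrightarrow> susc I (i, j) * (\<theta> i - \<theta> j) * x (i, j)"
      by (intro tendsto_mult tendsto_const T X that)
    moreover have "F n (i, j) = susc I (i, j) * (T n i - T n j) * X n (i, j)" for n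
      using that feas[of n] unfolding feasible_def by auto
    ultimately show "(\<lambda>n. F n (i, j)) \<longlonglongrightarrow> susc I (i, j) * (\<theta> i - \<theta> j) * x (i, j)"
      by simp
  qed
  moreover have "- cap I e * x e \<le> f e" "f e \<le> cap I e * x e" if "e \<in> branches I" for e
  proof -
    have "- cap I e * X n e \<le> F n e \<and> F n e \<le> cap I e * X n e" for n
      using that feas[of n] unfolding feasible_def by (cases e) auto
    then show "- cap I e * x e \<le> f e" "f e \<le> cap I e * x e"
      using LIMSEQ_le[OF tendsto_mult_left[OF X[OF that], of "- cap I e"] F[OF that]]
        LIMSEQ_le[OF F[OF that] tendsto_mult_left[OF X[OF that], of "cap I e"]]
      by blast+
  qed
  moreover have "pmin I i \<le> p i \<and> p i \<le> pmax I i" if "i \<in> gens I" for i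
    using that feas LIMSEQ_le_const[OF P[OF that]] LIMSEQ_le_const2[OF P[OF that]]
    unfolding feasible_def by blast
  moreover have "x e \<in> {0, 1}" if "e \<in> branches I" for e
  proof -
    \<comment> \<open>Integrality is written as a polynomial equation so that it passes to the
      limit.\<close>
    have "X n e * (X n e - 1) = 0" for n
      using that feas[of n] unfolding feasible_def by (cases e) auto
    moreover have "(\<lambda>n. X n e * (X n e - 1)) \<longlonglongrightarrow> x e * (x e - 1)"
      by (intro tendsto_intros X that)
    ultimately have "x e * (x e - 1) = 0"
      by (simp only: LIMSEQ_const_iff)
    then show ?thesis by simp
  qed
  ultimately show ?thesis unfolding feasible_def by auto
qed

text \<open>The angles of a feasible point may be unbounded, so a minimising sequence is first
  replaced by one with bounded angles and the same productions; a limit point then attains the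
  infimum.\<close>

lemma optimal_exists:
  assumes data: "dc_ots_data I" and conn: "connected_grid I"
    and ex: "\<exists>p f \<theta> x. feasible I p f \<theta> x"
  shows "\<exists>p f \<theta> x. optimal I p f \<theta> x"
proof -
  have fin: "finite (buses I)" "finite (branches I)" "finite (gens I)"
    using data finite_branches[OF data] finite_subset unfolding dc_ots_data_def by auto
  have ends: "fst e \<in> buses I" "snd e \<in> buses I" if "e \<in> branches I" for e
    using data that unfolding dc_ots_data_def by auto
  obtain K where K: "\<And>p f \<theta> x. feasible I p f \<theta> x \<Longrightarrow>
      \<exists>\<theta>' x'. feasible I p f \<theta>' x' \<and> (\<forall>i\<in>buses I. \<bar>\<theta>' i\<bar> \<le> K i)"
    using feasible_bounded_potentials[OF data conn] by blast
  have pbound: "\<bar>p i\<bar> \<le> \<bar>pmin I i\<bar> + \<bar>pmax I i\<bar>" if "feasible I p f \<theta> x" "i \<in> gens I" for p f \<theta> x i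
  proof -
    have "pmin I i \<le> p i" "p i \<le> pmax I i" using that unfolding feasible_def by auto
    then show ?thesis by linarith
  qed
  define S where "S = {total_cost I p | p. \<exists>f \<theta> x. feasible I p f \<theta> x}"
  have "bdd_below S"
  proof (rule bdd_belowI)
    fix c assume "c \<in> S"
    then obtain p f \<theta> x where c: "c = total_cost I p" "feasible I p f \<theta> x"
      by (auto simp: S_def)
    have "\<bar>total_cost I p\<bar> \<le> (\<Sum>i\<in>gens I. \<bar>cost I i\<bar> * (\<bar>pmin I i\<bar> + \<bar>pmax I i\<bar>))"
      unfolding total_cost_def using pbound[OF c(2)]
      by (intro order_trans[OF sum_abs] sum_mono) (auto simp: abs_mult intro!: mult_left_mono)
    then show "- (\<Sum>i\<in>gens I. \<bar>cost I i\<bar> * (\<bar>pmin I i\<bar> + \<bar>pmax I i\<bar>)) \<le> c"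
      using c(1) by linarith
  qed
  have "S \<noteq> {}" using ex by (auto simp: S_def)
  have "\<exists>p f \<theta> x. feasible I p f \<theta> x \<and> (\<forall>i\<in>buses I. \<bar>\<theta> i\<bar> \<le> K i) \<and>
          total_cost I p \<le> Inf S + 1 / real (Suc n)" for n
  proof -
    have "Inf S < Inf S + 1 / real (Suc n)" by simp
    then obtain c where "c \<in> S" "c < Inf S + 1 / real (Suc n)"
      using cInf_lessD[OF \<open>S \<noteq> {}\<close>] by blast
    then show ?thesis using K unfolding S_def by (smt (verit, best) mem_Collect_eq)
  qed
  then obtain P F T X where feas: "\<And>n. feasible I (P n) (F n) (T n) (X n)"
    and T: "\<And>n i. i \<in> buses I \<Longrightarrow> \<bar>T n i\<bar> \<le> K i"
    and cost: "\<And>n. total_cost I (P n) \<le> Inf S + 1 / real (Suc n)"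
    by metis
  \<comment> \<open>Productions, angles and switches are packed into one family over a disjoint sum,
    so that a single subsequence serves all of them. Flows are left out, being determined by the
    angles and switches.\<close>
  define g where "g n = case_sum (P n) (case_sum (T n) (X n))" for n
  have "Bseq (\<lambda>n. g n a)" if "a \<in> gens I <+> (buses I <+> branches I)" for a
    using that
  proof (elim PlusE)
    fix i assume "i \<in> gens I" "a = Inl i"
    then show ?thesis using pbound[OF feas]
      by (intro BseqI'[of _ "\<bar>pmin I i\<bar> + \<bar>pmax I i\<bar>"]) (simp add: g_def)
  next
    fix b i assume "i \<in> buses I" "b = Inl i" "a = Inr b"
    then show ?thesis using T by (intro BseqI'[of _ "K i"]) (simp add: g_def)
  next
    fix b e assume e: "e \<in> branches I" "b = Inr e" "a = Inr b"
    have "\<bar>X n e\<bar> \<le> 1" for n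
      using e(1) feas[of n] unfolding feasible_def by (cases e) auto
    then show ?thesis using e by (intro BseqI'[of _ 1]) (simp add: g_def)
  qed
  then obtain r l where r: "strict_mono (r :: nat \<Rightarrow> nat)"
    and l: "\<And>a. a \<in> gens I <+> (buses I <+> branches I) \<Longrightarrow> (\<lambda>n. g (r n) a) \<longlonglongrightarrow> l a"
    using pointwise_convergent_subsequence[of "gens I <+> (buses I <+> branches I)" g] fin by auto
  define p where "p i = l (Inl i)" for i
  define \<theta> where "\<theta> i = l (Inr (Inl i))" for i
  define x where "x e = l (Inr (Inr e))" for e
  \<comment> \<open>The limit flow is read off from the flow equation; convergence of the flows to
    it follows by continuity.\<close>
  define f where "f e = susc I e * (\<theta> (fst e) - \<theta> (snd e)) * x e" for e
  have P_lim: "(\<lambda>n. P (r n) i) \<longlonglongrightarrow> p i" if "i \<in> gens I" for i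
    using l[of "Inl i"] that by (simp add: g_def p_def InlI)
  have T_lim: "(\<lambda>n. T (r n) i) \<longlonglongrightarrow> \<theta> i" if "i \<in> buses I" for i
    using l[of "Inr (Inl i)"] that by (simp add: g_def \<theta>_def InlI InrI)
  have X_lim: "(\<lambda>n. X (r n) e) \<longlonglongrightarrow> x e" if "e \<in> branches I" for e
    using l[of "Inr (Inr e)"] that by (simp add: g_def x_def InrI)
  have F_lim: "(\<lambda>n. F (r n) e) \<longlonglongrightarrow> f e" if "e \<in> branches I" for e
  proof -
    have "F n e = susc I e * (T n (fst e) - T n (snd e)) * X n e" for n
      using that feas[of n] unfolding feasible_def by (cases e) auto
    then show ?thesis
      using ends[OF that] that unfolding f_def by (auto intro!: tendsto_intros T_lim X_lim)
  qed
  have "feasible I p f \<theta> x"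
    by (rule feasible_limit[of I "\<lambda>n. P (r n)" "\<lambda>n. F (r n)" "\<lambda>n. T (r n)" "\<lambda>n. X (r n)"])
      (auto intro!: fin feas P_lim F_lim X_lim tendsto_diff T_lim dest: ends)
  moreover have "total_cost I p \<le> total_cost I p'" if "feasible I p' f' \<theta>' x'" for p' f' \<theta>' x'
  proof -
    have "(\<lambda>n. total_cost I (P (r n))) \<longlonglongrightarrow> total_cost I p"
      unfolding total_cost_def by (intro tendsto_intros P_lim)
    moreover have "(\<lambda>n. Inf S + 1 / real (Suc (r n))) \<longlonglongrightarrow> Inf S + 0"
      using LIMSEQ_subseq_LIMSEQ[OF LIMSEQ_inverse_real_of_nat r]
      by (intro tendsto_intros) (simp add: o_def inverse_eq_divide)
    ultimately have "total_cost I p \<le> Inf S + 0"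
      by (rule LIMSEQ_le) (use cost in blast)
    also have "\<dots> \<le> total_cost I p'"
      using that \<open>bdd_below S\<close> by (auto simp: S_def intro!: cInf_lower)
    finally show ?thesis .
  qed
  ultimately show ?thesis unfolding optimal_def by blast
qed

section \<open>The big-M inequalities at an optimum with connected active graph\<close>

theorem mainTheorem1:
  fixes I :: "'a dc_ots"
  assumes "dc_ots_data I"
    and "connected_grid I"
    and "\<exists>p f \<theta> x. feasible I p f \<theta> x"
  shows "\<exists>p f \<theta> x. optimal I p f \<theta> x \<and>
           (\<forall>(i, j)\<in>branches I.
              - (1 - x (i, j)) * big_M I (i, j) \<le> f (i, j) - susc I (i, j) * (\<theta> i - \<theta> j) \<and>
              f (i, j) - susc I (i, j) * (\<theta> i - \<theta> j) \<le> (1 - x (i, j)) * big_M I (i, j))"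
proof -
  obtain p f \<theta>0 x0 where opt0: "optimal I p f \<theta>0 x0"
    using optimal_exists[OF assms] by blast
  then have "feasible I p f \<theta>0 x0" unfolding optimal_def by blast
  \<comment> \<open>Only angles and switches are exchanged; \<open>p\<close> is kept, so the cost
    stays optimal.\<close>
  then obtain \<theta> x where feas: "feasible I p f \<theta> x"
    and c: "\<forall>i\<in>buses I. \<forall>j\<in>buses I. \<exists>P. path (active I x) i P j"
    using feasible_connected[OF assms(1,2)] by blast
  have "optimal I p f \<theta> x" using opt0 feas unfolding optimal_def by blast
  moreover have "\<bar>f (i, j) - susc I (i, j) * (\<theta> i - \<theta> j)\<bar> \<le> (1 - x (i, j)) * big_M I (i, j)"
    if ij: "(i, j) \<in> branches I" for i j
  proof -
    have eqs: "f (i, j) = susc I (i, j) * (\<theta> i - \<theta> j) * x (i, j)" "x (i, j) \<in> {0, 1}"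
      "susc I (i, j) > 0"
      using ij feas assms(1) unfolding feasible_def dc_ots_data_def by auto
    have "i \<in> buses I" "j \<in> buses I" using ij assms(1) unfolding dc_ots_data_def by auto
    then have "\<bar>\<theta> i - \<theta> j\<bar> \<le> longest_path I i j"
      using c active_potential_bound[OF assms(1) feas] by blast
    then have "\<bar>susc I (i, j) * (\<theta> i - \<theta> j)\<bar> \<le> big_M I (i, j)"
      using eqs(3) by (simp add: big_M_def longest_path_def abs_mult)
    \<comment> \<open>For \<open>x (i, j) = 1\<close> both sides are 0. For
      \<open>x (i, j) = 0\<close> the flow is 0 and the bound just shown remains.\<close>
    then show ?thesis using eqs by auto
  qed
  then have "\<forall>(i, j)\<in>branches I.
      - (1 - x (i, j)) * big_M I (i, j) \<le> f (i, j) - susc I (i, j) * (\<theta> i - \<theta> j) \<and>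
      f (i, j) - susc I (i, j) * (\<theta> i - \<theta> j) \<le> (1 - x (i, j)) * big_M I (i, j)"
    unfolding abs_le_iff minus_mult_left[symmetric] minus_le_iff[of "_ * big_M I _"] by blast
  ultimately show ?thesis by blast
qed

end
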